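(* Let $\varepsilon\in M_n(\{0,1\})$ be symmetric with zero diagonal, regarded as the adjacency matrix of an undirected graph $\Gamma_\varepsilon$ on the vertices $\{1,\dots,n\}$. The $\varepsilon$-symmetric quantum group $S_n^\varepsilon$ coincides with the quantum automorphism group of $\Gamma_\varepsilon$ as defined by Bichon, and it is a quantum subgroup of the quantum automorphism group $S_n^{\Gamma_\varepsilon}$ as defined by Banica, i.e. $S_n^\varepsilon\subset S_n^{\Gamma_\varepsilon}$.
   Context: All algebras below are universal unital $C^*$-algebras generated by $u_{ij}$, $1\le i,j\le n$, containing the relations ("magic unitary") $u_{ij}=u_{ij}^*=u_{ij}^2$ and $\sum_k u_{ik}=\sum_k u_{kj}=1$ for all $i,j$. - $C(S_n^\varepsilon)$: magic unitary relations together with $\mathring R^\varepsilon$: $u_{ik}u_{jl}=u_{jl}u_{ik}$ if $\varepsilon_{ij}=1$ and $\varepsilon_{kl}=1$; $u_{ik}u_{jl}=0$ if $\varepsilon_{ij}=1$ and $\varepsilon_{kl}=0$; $u_{ik}u_{jl}=0$ if $\varepsilon_{ij}=0$ and $\varepsilon_{kl}=1$. - Bichon's quantum automorphism group of $\Gamma_\varepsilon$: magic unitary relations together with (3.2) $u_{ik}u_{jl}=u_{jl}u_{ik}=0$ whenever exactly one of $\varepsilon_{ij}=1$, $\varepsilon_{kl}=1$ holds; (3.3) $u_{ik}u_{jl}=u_{jl}u_{ik}$ whenever $\varepsilon_{ij}=1$ and $\varepsilon_{kl}=1$; (3.4) $\sum_{i,j:\,\varepsilon_{ij}=1}u_{ik}u_{jl}=1$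 whenever $\varepsilon_{kl}=1$. - Banica's quantum automorphism group, $C(S_n^{\Gamma_\varepsilon})$: magic unitary relations together with $u\varepsilon=\varepsilon u$, i.e. $\sum_{k:\varepsilon_{kl}=1}u_{ik}=\sum_{j:\varepsilon_{ij}=1}u_{jl}$ for all $i,l$. "Coincides" means that there is a $*$-isomorphism of the $C^*$-algebras sending generators $u_{ij}$ to generators $u_{ij}$; $G\subset H$ means that there is a surjective $*$-homomorphism $C(H)\to C(G)$ sending $u_{ij}$ to $u_{ij}$. *)

theory Defs
  imports
    "HOL-Analysis.Finite_Cartesian_Product"
    "HOL-Library.Poly_Mapping"
    "HOL-Algebra.Module"
begin

section \<open>Noncommutative *-polynomials\<close>

text \<open>
  A letter \<open>(g, False)\<close> stands for the generator \<open>g\<close> and \<open>(g, True)\<close> for its formal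
  adjoint. Words are written additively because the convolution product of \<^theory>\<open>HOL-Library.Poly_Mapping\<close>
  expects an (in general noncommutative) additive monoid of exponents.
\<close>

datatype 'g word = Word (letters: "('g \<times> bool) list")

instantiation word :: (type) monoid_add
begin

definition zero_word :: "'a word" where
  "zero_word = Word []"

definition plus_word :: "'a word \<Rightarrow> 'a word \<Rightarrow> 'a word" where
  "plus_word v w = Word (letters v @ letters w)"

instance
  by standard (simp_all add: zero_word_def plus_word_def)

end

type_synonym 'g star_poly = "'g word \<Rightarrow>\<^sub>0 complex"

definition star_word :: "'g word \<Rightarrow> 'g word" where
  "star_word w = Word (rev (map (\<lambda>(g, b). (g, \<not> b)) (letters w)))"

definition star_poly :: "'g star_poly \<Rightarrow> 'g star_poly" where
  "star_poly p = Poly_Mapping.map cnj (Poly_Mapping.map_key star_word p)"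

definition scale_poly :: "complex \<Rightarrow> 'g star_poly \<Rightarrow> 'g star_poly" where
  "scale_poly c p = Poly_Mapping.single 0 c * p"

definition gen_poly :: "'g \<Rightarrow> 'g star_poly" where
  "gen_poly g = Poly_Mapping.single (Word [(g, False)]) 1"

lemma star_word_star_word [simp]: "star_word (star_word w) = w"
  by (cases w) (simp add: star_word_def rev_map [symmetric] comp_def case_prod_unfold)

lemma lookup_star_poly:
  "Poly_Mapping.lookup (star_poly p) w = cnj (Poly_Mapping.lookup p (star_word w))"
proof -
  have "inj star_word"
    by (metis injI star_word_star_word)
  then show ?thesis
    by (auto simp: star_poly_def map.rep_eq map_key.rep_eq[OF \<open>inj star_word\<close>] when_def)
qed


section \<open>Universal unital C*-algebras\<close>

text \<open>
  A relation is a pair \<open>(l, r)\<close> of *-polynomials, read as \<open>l = r\<close>. The C*-seminorms that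
  vanish on all \<open>l - r\<close> are exactly the C*-seminorms on the quotient of the free unital
  *-algebra by the two-sided *-ideal generated by the relations.
\<close>

definition cstar_seminorm :: "('g star_poly \<Rightarrow> real) \<Rightarrow> bool" where
  "cstar_seminorm p \<longleftrightarrow>
     (\<forall>x. 0 \<le> p x) \<and>
     (\<forall>x y. p (x + y) \<le> p x + p y) \<and>
     (\<forall>c x. p (scale_poly c x) = cmod c * p x) \<and>
     (\<forall>x y. p (x * y) \<le> p x * p y) \<and>
     (\<forall>x. p (star_poly x * x) = (p x)\<^sup>2)"

definition cstar_seminorms :: "('g star_poly \<times> 'g star_poly) set \<Rightarrow> ('g star_poly \<Rightarrow> real) set" where
  "cstar_seminorms R = {p. cstar_seminorm p \<and> (\<forall>(l, r)\<in>R. p (l - r) = 0)}"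

text \<open>
  This is meaningful only if the supremum is finite; \<open>bdd_above_cstar_seminorms\<close> below shows
  that it is, whenever the relations contain those of a magic unitary. The set is never
  empty, since it contains the zero seminorm.
\<close>

definition univ_seminorm :: "('g star_poly \<times> 'g star_poly) set \<Rightarrow> 'g star_poly \<Rightarrow> real" where
  "univ_seminorm R x = (SUP p\<in>cstar_seminorms R. p x)"

definition cauchy_seqs :: "('g star_poly \<times> 'g star_poly) set \<Rightarrow> (nat \<Rightarrow> 'g star_poly) set" where
  "cauchy_seqs R = {x. \<forall>e>0. \<exists>N. \<forall>m\<ge>N. \<forall>k\<ge>N. univ_seminorm R (x m - x k) < e}"

definition cauchy_rel ::
    "('g star_poly \<times> 'g star_poly) set \<Rightarrow> ((nat \<Rightarrow> 'g star_poly) \<times> (nat \<Rightarrow> 'g star_poly)) set" where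
  "cauchy_rel R = {(x, y). x \<in> cauchy_seqs R \<and> y \<in> cauchy_seqs R \<and>
     (\<lambda>k. univ_seminorm R (x k - y k)) \<longlonglongrightarrow> 0}"

definition cauchy_class ::
    "('g star_poly \<times> 'g star_poly) set \<Rightarrow> (nat \<Rightarrow> 'g star_poly) \<Rightarrow> (nat \<Rightarrow> 'g star_poly) set" where
  "cauchy_class R x = cauchy_rel R `` {x}"

definition cauchy_rep :: "(nat \<Rightarrow> 'g star_poly) set \<Rightarrow> nat \<Rightarrow> 'g star_poly" where
  "cauchy_rep X = (SOME x. x \<in> X)"

record 'a cstar_struct = "(complex, 'a) module" +
  star :: "'a \<Rightarrow> 'a"
  cnorm :: "'a \<Rightarrow> real"

text \<open>
  The completion of the free *-algebra with respect to the universal C*-seminorm.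
  Passing to classes of Cauchy sequences also divides out the null space of the seminorm.
\<close>

definition univ_cstar ::
    "('g star_poly \<times> 'g star_poly) set \<Rightarrow> (nat \<Rightarrow> 'g star_poly) set cstar_struct" where
  "univ_cstar R =
    \<lparr> carrier = cauchy_seqs R // cauchy_rel R,
      monoid.mult = (\<lambda>X Y. cauchy_class R (\<lambda>k. cauchy_rep X k * cauchy_rep Y k)),
      one = cauchy_class R (\<lambda>k. 1),
      zero = cauchy_class R (\<lambda>k. 0),
      add = (\<lambda>X Y. cauchy_class R (\<lambda>k. cauchy_rep X k + cauchy_rep Y k)),
      smult = (\<lambda>c X. cauchy_class R (\<lambda>k. scale_poly c (cauchy_rep X k))),
      star = (\<lambda>X. cauchy_class R (\<lambda>k. star_poly (cauchy_rep X k))),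
      cnorm = (\<lambda>X. lim (\<lambda>k. univ_seminorm R (cauchy_rep X k))) \<rparr>"

definition univ_gen :: "('g star_poly \<times> 'g star_poly) set \<Rightarrow> 'g \<Rightarrow> (nat \<Rightarrow> 'g star_poly) set" where
  "univ_gen R g = cauchy_class R (\<lambda>k. gen_poly g)"

text \<open>Unital *-homomorphisms: \<^const>\<open>ring_hom\<close> includes preservation of the unit.\<close>

definition star_hom :: "'a cstar_struct \<Rightarrow> 'b cstar_struct \<Rightarrow> ('a \<Rightarrow> 'b) set" where
  "star_hom A B = {h \<in> ring_hom A B.
     (\<forall>c. \<forall>x\<in>carrier A. h (c \<odot>\<^bsub>A\<^esub> x) = c \<odot>\<^bsub>B\<^esub> h x) \<and>
     (\<forall>x\<in>carrier A. h (star A x) = star B (h x))}"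

definition star_iso :: "'a cstar_struct \<Rightarrow> 'b cstar_struct \<Rightarrow> ('a \<Rightarrow> 'b) set" where
  "star_iso A B = {h \<in> star_hom A B. bij_betw h (carrier A) (carrier B)}"


section \<open>Quantum permutation groups given by relations\<close>

text \<open>
  A quantum permutation group on the points \<open>'n\<close> is presented by a set of relations between
  the generators \<open>u i j\<close>; its algebra of functions is the universal C*-algebra.
\<close>

type_synonym 'n rels = "(('n \<times> 'n) star_poly \<times> ('n \<times> 'n) star_poly) set"

abbreviation u :: "'n \<Rightarrow> 'n \<Rightarrow> ('n \<times> 'n) star_poly" where
  "u i j \<equiv> gen_poly (i, j)"

definition coincides :: "'n rels \<Rightarrow> 'n rels \<Rightarrow> bool" where
  "coincides G H \<longleftrightarrow> (\<exists>h \<in> star_iso (univ_cstar G) (univ_cstar H).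
     \<forall>i j. h (univ_gen G (i, j)) = univ_gen H (i, j))"

definition quantum_subgroup :: "'n rels \<Rightarrow> 'n rels \<Rightarrow> bool" where
  "quantum_subgroup G H \<longleftrightarrow> (\<exists>h \<in> star_hom (univ_cstar H) (univ_cstar G).
     h ` carrier (univ_cstar H) = carrier (univ_cstar G) \<and>
     (\<forall>i j. h (univ_gen H (i, j)) = univ_gen G (i, j)))"

definition magic_rels :: "('n::finite) rels" where
  "magic_rels =
     {(u i j, star_poly (u i j)) | i j. True} \<union>
     {(u i j, u i j * u i j) | i j. True} \<union>
     {(\<Sum>k\<in>UNIV. u i k, 1) | i. True} \<union>
     {(\<Sum>k\<in>UNIV. u k j, 1) | j. True}"

definition eps_sym_rels :: "nat^'n^'n \<Rightarrow> ('n::finite) rels" where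
  "eps_sym_rels \<epsilon> = magic_rels \<union>
     {(u i k * u j l, u j l * u i k) | i j k l. \<epsilon>$i$j = 1 \<and> \<epsilon>$k$l = 1} \<union>
     {(u i k * u j l, 0) | i j k l. \<epsilon>$i$j = 1 \<and> \<epsilon>$k$l = 0} \<union>
     {(u i k * u j l, 0) | i j k l. \<epsilon>$i$j = 0 \<and> \<epsilon>$k$l = 1}"

definition bichon_rels :: "nat^'n^'n \<Rightarrow> ('n::finite) rels" where
  "bichon_rels \<epsilon> = magic_rels \<union>
     {(u i k * u j l, u j l * u i k) | i j k l. (\<epsilon>$i$j = 1) \<noteq> (\<epsilon>$k$l = 1)} \<union>
     {(u j l * u i k, 0) | i j k l. (\<epsilon>$i$j = 1) \<noteq> (\<epsilon>$k$l = 1)} \<union>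
     {(u i k * u j l, u j l * u i k) | i j k l. \<epsilon>$i$j = 1 \<and> \<epsilon>$k$l = 1} \<union>
     {(\<Sum>(i, j)\<in>{(i, j). \<epsilon>$i$j = 1}. u i k * u j l, 1) | k l. \<epsilon>$k$l = 1}"

definition banica_rels :: "nat^'n^'n \<Rightarrow> ('n::finite) rels" where
  "banica_rels \<epsilon> = magic_rels \<union>
     {(\<Sum>k\<in>{k. \<epsilon>$k$l = 1}. u i k, \<Sum>j\<in>{j. \<epsilon>$i$j = 1}. u j l) | i l. True}"


section \<open>Finiteness of the universal seminorm\<close>

lemma bdd_above_cstar_seminorms:
  fixes R :: "('n::finite) rels"
  assumes "magic_rels \<subseteq> R"
  shows "bdd_above ((\<lambda>p. p x) ` cstar_seminorms R)"
proof -
  have le1: "t \<le> 1" if "t = t\<^sup>2" for t :: real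
    using that by (auto simp: power2_eq_square)
  have diff0: "p a \<le> p b" if p: "cstar_seminorm p" and "p (a - b) = 0" for p :: "('n \<times> 'n) star_poly \<Rightarrow> real" and a b
  proof -
    have "p (a - b + b) \<le> p (a - b) + p b"
      using p unfolding cstar_seminorm_def by blast
    then show ?thesis using that by simp
  qed
  have star_single: "star_poly (Poly_Mapping.single w c) = Poly_Mapping.single (star_word w) (cnj c)"
    for w :: "('n \<times> 'n) word" and c
    by (rule poly_mapping_eqI)
      (auto simp: lookup_star_poly lookup_single when_def)
  have star_inv: "star_poly (star_poly y) = y" for y :: "('n \<times> 'n) star_poly"
    by (rule poly_mapping_eqI) (simp add: lookup_star_poly)
  have letter: "p (Poly_Mapping.single (Word [(g, b)]) 1) \<le> 1"
    if p: "p \<in> cstar_seminorms R" for p g b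
  proof -
    obtain i j where g: "g = (i, j)" by (cases g)
    have sp: "cstar_seminorm p" and van: "\<And>l r. (l, r) \<in> R \<Longrightarrow> p (l - r) = 0"
      using p by (auto simp: cstar_seminorms_def)
    have neg: "p (- y) = p y" for y
    proof -
      have "scale_poly (- 1) y = - y"
        by (simp add: scale_poly_def single_uminus)
      then show ?thesis using sp unfolding cstar_seminorm_def
        by (metis mult_1 norm_minus_cancel norm_one)
    qed
    have sub: "p (a - b) = p (b - a)" for a b
      by (metis minus_diff_eq neg)
    let ?s = "star_poly (u i j)"
    have m1: "p (u i j - ?s) = 0"
      by (rule van) (use assms in \<open>auto simp: magic_rels_def\<close>)
    have m2: "p (u i j - u i j * u i j) = 0"
      by (rule van) (use assms in \<open>auto simp: magic_rels_def\<close>)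
    have e1: "p (u i j) = p ?s"
      using diff0[OF sp m1] diff0[OF sp m1[unfolded sub[of "u i j"]]] by simp
    have e2: "p (u i j) = p (u i j * u i j)"
      using diff0[OF sp m2] diff0[OF sp m2[unfolded sub[of "u i j"]]] by simp
    have "p (?s * u i j - u i j * u i j) = p ((?s - u i j) * u i j)"
      by (simp add: left_diff_distrib)
    also have "\<dots> \<le> p (?s - u i j) * p (u i j)"
      using sp unfolding cstar_seminorm_def by blast
    also have "\<dots> = 0" using m1 sub by simp
    finally have "p (?s * u i j - u i j * u i j) = 0"
      using sp unfolding cstar_seminorm_def by (meson order_antisym)
    then have "p (?s * u i j) = p (u i j * u i j)"
      using diff0[OF sp] sub by (metis order_antisym)
    then have "p (u i j) = (p (u i j))\<^sup>2"
      using e2 sp unfolding cstar_seminorm_def by metis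
    then have "p (u i j) \<le> 1" by (rule le1)
    moreover have "?s = Poly_Mapping.single (Word [(g, True)]) 1"
      by (simp add: gen_poly_def star_single star_word_def g)
    ultimately show ?thesis
      using e1 by (cases b) (auto simp: gen_poly_def g)
  qed
  have word: "p (Poly_Mapping.single (Word ls) 1) \<le> 1"
    if p: "p \<in> cstar_seminorms R" for p ls
  proof (induction ls)
    case Nil
    have sp: "cstar_seminorm p" using p by (simp add: cstar_seminorms_def)
    have "star_poly 1 = (1 :: ('n \<times> 'n) star_poly)"
      by (simp only: single_one[symmetric] star_single) (simp add: star_word_def zero_word_def)
    then have "p 1 = (p 1)\<^sup>2"
      using sp unfolding cstar_seminorm_def by (metis mult_1)
    then show ?case using le1 by (simp add: single_one flip: zero_word_def)
  next
    case (Cons l ls)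
    have sp: "cstar_seminorm p" using p by (simp add: cstar_seminorms_def)
    obtain g b where l: "l = (g, b)" by (cases l)
    have "Poly_Mapping.single (Word (l # ls)) (1 :: complex)
        = Poly_Mapping.single (Word [l]) 1 * Poly_Mapping.single (Word ls) 1"
      by (simp add: mult_single plus_word_def)
    then have "p (Poly_Mapping.single (Word (l # ls)) 1)
        \<le> p (Poly_Mapping.single (Word [l]) 1) * p (Poly_Mapping.single (Word ls) 1)"
      using sp unfolding cstar_seminorm_def by metis
    also have "\<dots> \<le> 1"
      using sp letter[OF p, of g b] Cons unfolding cstar_seminorm_def l
      by (intro mult_le_one) auto
    finally show ?case .
  qed
  have "\<exists>B. \<forall>p\<in>cstar_seminorms R. p x \<le> B"
  proof (induction x rule: update_induct)
    case const
    have "p 0 = 0" if "p \<in> cstar_seminorms R" for p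
    proof -
      have "p (scale_poly 0 0) = cmod 0 * p 0"
        using that unfolding cstar_seminorms_def cstar_seminorm_def by blast
      then show ?thesis by (simp add: scale_poly_def)
    qed
    then show ?case by (metis order_refl)
  next
    case (update f a b)
    then obtain B where B: "\<forall>p\<in>cstar_seminorms R. p f \<le> B" by blast
    have eq: "Poly_Mapping.update a b f = f + scale_poly b (Poly_Mapping.single a 1)"
      by (rule poly_mapping_eqI)
        (use update in \<open>auto simp: lookup_update lookup_add lookup_single when_def
          scale_poly_def mult_single in_keys_iff\<close>)
    have "p (Poly_Mapping.update a b f) \<le> B + cmod b" if p: "p \<in> cstar_seminorms R" for p
    proof -
      have "p (Poly_Mapping.update a b f) \<le> p f + cmod b * p (Poly_Mapping.single a 1)"
        using p unfolding eq cstar_seminorms_def cstar_seminorm_def by (metis (mono_tags, lifting) mem_Collect_eq)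
      also have "cmod b * p (Poly_Mapping.single a 1) \<le> cmod b"
        using word[OF p, of "letters a"] by (simp add: mult_left_le)
      finally show ?thesis using B p by fastforce
    qed
    then show ?case by blast
  qed
  then show ?thesis by (auto intro: bdd_aboveI2)
qed

end

theory Submission
  imports Defs
begin

text \<open>
  Modulo the relations of a magic unitary, the relations of the \<open>\<epsilon>\<close>-symmetric quantum group and
  of Bichon's quantum automorphism group vanish under the same C*-seminorms, and these imply
  Banica's relations; so the first two completions are literally equal. For Banica's algebra the
  identity on *-polynomials induces a *-homomorphism with dense image, and the point is that its
  range is closed. If \<open>x\<close> is small in the target but has large norm \<open>m\<close> in the source, then
  passing from \<open>x\<close> to \<open>x (1 - h\<^sup>2)\<close>, where \<open>h = x\<^sup>* x / m\<^sup>2\<close>, shrinks the norm in the source by a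
  fixed factor while hardly moving \<open>x\<close> in the target. Iterating yields approximate
  lifts of controlled norm, hence a lift of every Cauchy sequence.
\<close>

section \<open>The free *-algebra\<close>

lemma lookup_scale_poly [simp]:
  "Poly_Mapping.lookup (scale_poly c x) w = c * Poly_Mapping.lookup x w"
  by (simp add: scale_poly_def flip: mult_map_scale_conv_mult) (simp add: map.rep_eq when_def)

text \<open>In contrast to \<open>update_induct\<close>, the step is additive, so identities that
  are additive in each argument reduce to monomials.\<close>

lemma poly_mapping_add_induct [case_names zero single add]:
  assumes "P 0" "\<And>w c. P (Poly_Mapping.single w c)" "\<And>x y. P x \<Longrightarrow> P y \<Longrightarrow> P (x + y)"
  shows "P x"
proof (induction x rule: update_induct)
  case (update f a b)
  have "Poly_Mapping.update a b f = f + Poly_Mapping.single a b"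
    by (rule poly_mapping_eqI)
      (use update in \<open>auto simp: lookup_update lookup_add lookup_single when_def in_keys_iff\<close>)
  then show ?case
    using update assms by simp
qed (fact assms)

lemma scale_poly_add: "scale_poly c (x + y) = scale_poly c x + scale_poly c y"
  by (simp add: scale_poly_def distrib_left)

lemma scale_poly_diff: "scale_poly c (x - y) = scale_poly c x - scale_poly c y"
  by (simp add: scale_poly_def right_diff_distrib)

lemma scale_poly_0 [simp]: "scale_poly c 0 = 0"
  by (simp add: scale_poly_def)

lemma scale_poly_scale_poly [simp]: "scale_poly c (scale_poly d x) = scale_poly (c * d) x"
  by (rule poly_mapping_eqI) simp

lemma scale_poly_1 [simp]: "scale_poly 1 x = x"
  by (rule poly_mapping_eqI) simp

lemma scale_poly_minus1: "scale_poly (- 1) x = - x"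
  by (rule poly_mapping_eqI) simp

lemma scale_poly_mult_left: "scale_poly c x * y = scale_poly c (x * y)"
  by (simp add: scale_poly_def mult.assoc)

text \<open>Words do not commute, but the empty word is central, so scalars move past the left
  factor.\<close>

lemma scale_poly_mult_right: "x * scale_poly c y = scale_poly c (x * y)"
proof -
  have "x * Poly_Mapping.single 0 c = Poly_Mapping.single 0 c * x"
    by (induction x rule: poly_mapping_add_induct)
      (simp_all add: mult_single distrib_left distrib_right mult.commute)
  then show ?thesis
    by (metis mult.assoc scale_poly_def)
qed

lemma star_poly_single:
  "star_poly (Poly_Mapping.single w c) = Poly_Mapping.single (star_word w) (cnj c)"
  by (rule poly_mapping_eqI) (auto simp: lookup_star_poly lookup_single when_def)

lemma star_poly_star_poly [simp]: "star_poly (star_poly x) = x"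
  by (rule poly_mapping_eqI) (simp add: lookup_star_poly)

lemma star_poly_0 [simp]: "star_poly 0 = 0"
  by (rule poly_mapping_eqI) (simp add: lookup_star_poly)

lemma star_poly_add: "star_poly (x + y) = star_poly x + star_poly y"
  by (rule poly_mapping_eqI) (simp add: lookup_star_poly lookup_add)

lemma star_poly_diff: "star_poly (x - y) = star_poly x - star_poly y"
  by (rule poly_mapping_eqI) (simp add: lookup_star_poly lookup_minus)

lemma star_poly_scale: "star_poly (scale_poly c x) = scale_poly (cnj c) (star_poly x)"
  by (rule poly_mapping_eqI) (simp add: lookup_star_poly)

lemma star_poly_1 [simp]: "star_poly 1 = 1"
  by (simp only: single_one[symmetric] star_poly_single) (simp add: star_word_def zero_word_def)

lemma star_poly_mult: "star_poly (x * y) = star_poly y * star_poly x"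
proof (induction x rule: poly_mapping_add_induct)
  case (single v c)
  show ?case
    by (induction y rule: poly_mapping_add_induct)
      (simp_all add: mult_single star_poly_single star_poly_add distrib_left distrib_right
        star_word_def plus_word_def mult.commute)
qed (simp_all add: star_poly_add distrib_left distrib_right)


section \<open>C*-seminorms\<close>

locale cstar_seminormed =
  fixes p :: "'g star_poly \<Rightarrow> real"
  assumes cstar_seminorm: "cstar_seminorm p"
begin

lemma nonneg [simp]: "0 \<le> p x"
  and triangle: "p (x + y) \<le> p x + p y"
  and scale: "p (scale_poly c x) = cmod c * p x"
  and submult: "p (x * y) \<le> p x * p y"
  and cstar: "p (star_poly x * x) = (p x)\<^sup>2"
  using cstar_seminorm unfolding cstar_seminorm_def by blast+

lemma zero [simp]: "p 0 = 0"
  using scale[of 0 0] by simp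

lemma minus [simp]: "p (- x) = p x"
  using scale[of "- 1" x] by (simp add: scale_poly_minus1)

lemma diff_commute: "p (x - y) = p (y - x)"
  by (metis minus minus_diff_eq)

lemma triangle_diff: "p (x - y) \<le> p x + p y"
  using triangle[of x "- y"] by simp

lemma triangle_mid: "p (x - z) \<le> p (x - y) + p (y - z)"
  using triangle[of "x - y" "y - z"] by simp

lemma le_add_diff: "p x \<le> p y + p (x - y)"
  using triangle[of y "x - y"] by simp

text \<open>By the C*-identity \<open>p 1\<close> equals its own square, hence is 0 or 1; the value
  0 occurs for the zero seminorm.\<close>

lemma one_le: "p 1 \<le> 1"
proof -
  have "p 1 = (p 1)\<^sup>2" using cstar[of 1] by simp
  then show ?thesis by (auto simp: power2_eq_square)
qed

text \<open>The C*-identity and submultiplicativity bound \<open>(p x)\<^sup>2\<close> by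
  \<open>p (star_poly x) * p x\<close>. Cancelling \<open>p x\<close> gives one inequality, and
  involutivity the other.\<close>

lemma star [simp]: "p (star_poly x) = p x"
proof -
  have "p x \<le> p (star_poly x)" for x
  proof (cases "p x = 0")
    case False
    have "p x * p x \<le> p (star_poly x) * p x"
      using cstar[of x] submult[of "star_poly x" x] by (simp add: power2_eq_square)
    then show ?thesis
      using False nonneg[of x] by (metis antisym_conv1 mult_right_le_imp_le)
  qed simp
  then show ?thesis
    by (metis antisym star_poly_star_poly)
qed

lemma selfadjoint_square: "star_poly h = h \<Longrightarrow> p (h * h) = (p h)\<^sup>2"
  using cstar[of h] by simp

lemma mult_diff_le:
  "p (x * y - x' * y') \<le> p (x - x') * p y + p x' * p (y - y')"
proof -
  have "x * y - x' * y' = (x - x') * y + x' * (y - y')"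
    by (simp add: algebra_simps)
  then show ?thesis
    using triangle[of "(x - x') * y" "x' * (y - y')"] submult[of "x - x'" y] submult[of x' "y - y'"]
    by simp
qed

end

section \<open>Norm bounds for polynomials in a selfadjoint element\<close>

text \<open>
  With \<open>a = h\<^sup>2\<close>, this is the Visser iteration for \<open>1 - sqrt (1 - a)\<close>.
\<close>

primrec sqrt_iter :: "'g star_poly \<Rightarrow> nat \<Rightarrow> 'g star_poly" where
  "sqrt_iter a 0 = 0"
| "sqrt_iter a (Suc k) = scale_poly (1 / 2) (a + sqrt_iter a k * sqrt_iter a k)"

lemma star_sqrt_iter: "star_poly a = a \<Longrightarrow> star_poly (sqrt_iter a k) = sqrt_iter a k"
  by (induction k) (simp_all add: star_poly_scale star_poly_add star_poly_mult)

lemma sqrt_iter_commute: "h * sqrt_iter (h * h) k = sqrt_iter (h * h) k * h"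
proof (induction k)
  case (Suc k)
  let ?y = "sqrt_iter (h * h) k"
  have "h * (?y * ?y) = ?y * ?y * h"
    by (simp add: Suc flip: mult.assoc) (simp add: Suc mult.assoc)
  then show ?case
    by (simp add: scale_poly_mult_left scale_poly_mult_right distrib_left distrib_right mult.assoc)
qed simp

context cstar_seminormed
begin

text \<open>The map y \<mapsto> (a + y^2) / 2 preserves the ball of radius \<open>r\<close>, because
  (r + r^2) / 2 \<le> r.\<close>

lemma sqrt_iter_le:
  assumes "p a \<le> r" "r \<le> 1"
  shows "p (sqrt_iter a k) \<le> r"
proof -
  have "0 \<le> r" using assms(1) nonneg[of a] by linarith
  show ?thesis
  proof (induction k)
    case (Suc k)
    let ?y = "sqrt_iter a k"
    have "p (a + ?y * ?y) \<le> r + r * r"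
      using triangle[of a "?y * ?y"] submult[of ?y ?y] assms(1)
        mult_mono[OF Suc Suc \<open>0 \<le> r\<close> nonneg] by linarith
    also have "\<dots> \<le> 2 * r"
      using \<open>0 \<le> r\<close> assms(2) mult_left_le by fastforce
    finally show ?case by (simp add: scale norm_divide)
  qed (simp add: \<open>0 \<le> r\<close>)
qed

text \<open>A difference of squares telescopes into two products, each with one factor of norm at
  most \<open>r\<close>; after halving, the increments contract by \<open>r\<close>.\<close>

lemma sqrt_iter_diff_le:
  assumes "p a \<le> r" "r \<le> 1"
  shows "p (sqrt_iter a (Suc k) - sqrt_iter a k) \<le> r ^ Suc k"
proof (induction k)
  case 0
  then show ?case using assms order_trans[OF nonneg assms(1)] by (simp add: scale norm_divide)
next
  case (Suc k)
  let ?y = "sqrt_iter a k" and ?z = "sqrt_iter a (Suc k)"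
  have "0 \<le> r" using assms(1) nonneg[of a] by linarith
  have "sqrt_iter a (Suc (Suc k)) - ?z = scale_poly (1 / 2) (?z * ?z - ?y * ?y)"
    by (simp only: sqrt_iter.simps(2)[of a "Suc k"] sqrt_iter.simps(2)[of a k])
      (simp add: scale_poly_add scale_poly_diff)
  then have "p (sqrt_iter a (Suc (Suc k)) - ?z) = p (?z * ?z - ?y * ?y) / 2"
    by (simp add: scale norm_divide)
  also have "\<dots> \<le> (p (?z - ?y) * p ?z + p ?y * p (?z - ?y)) / 2"
    by (intro divide_right_mono mult_diff_le) simp
  also have "\<dots> \<le> (r ^ Suc k * r + r * r ^ Suc k) / 2"
    by (intro divide_right_mono add_mono mult_mono Suc sqrt_iter_le[OF assms])
      (use \<open>0 \<le> r\<close> in auto)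
  finally show ?case by simp
qed

text \<open>
  Writing \<open>s = sqrt (1 - h\<^sup>2)\<close>, the element \<open>v = h + \<i> s\<close> is unitary and \<open>1 - 2 h\<^sup>2\<close> is minus the real
  part of \<open>v\<^sup>2\<close>. As \<open>s\<close> need not exist in the free algebra, \<open>v\<close> is only approximately unitary.
\<close>

lemma cos_double_le_strict:
  assumes h: "star_poly h = h" and r: "p (h * h) \<le> r" "r < 1"
  shows "p (1 - h * h - h * h) \<le> 1"
proof -
  have "0 \<le> r" using r(1) nonneg[of "h * h"] by linarith
  have bound: "p (1 - h * h - h * h) \<le> 1 + 4 * r ^ Suc k" for k
  proof -
    let ?y = "sqrt_iter (h * h) k"
    define s where "s = 1 - ?y"
    define e where "e = p (h * h + s * s - 1)"
    define q where "q = scale_poly \<i> s"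
    define v where "v = h + q"
    have s: "star_poly s = s" and hs: "h * s = s * h"
      by (simp_all add: s_def star_poly_diff star_sqrt_iter star_poly_mult h
          algebra_simps sqrt_iter_commute)
    have q: "q * q = - (s * s)" "h * q = q * h" "star_poly q = - q"
      by (simp_all add: q_def scale_poly_mult_left scale_poly_mult_right scale_poly_minus1
          hs s star_poly_scale flip: scale_poly_minus1)
    \<comment> \<open>As s = 1 - y, the defect from unitarity is h^2 - 2 y + y^2, twice the next
      increment of the iteration.\<close>
    have "h * h + s * s - 1 = scale_poly 2 (sqrt_iter (h * h) (Suc k) - ?y)"
    proof -
      have "scale_poly 2 ?y = ?y + ?y"
        by (rule poly_mapping_eqI) (simp add: lookup_add)
      then show ?thesis
        by (simp add: s_def scale_poly_diff algebra_simps)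
    qed
    then have e: "e \<le> 2 * r ^ Suc k"
      using sqrt_iter_diff_le[OF r(1), of k] r(2) by (simp add: e_def scale del: sqrt_iter.simps)
    have star_v: "star_poly v = h - q"
      by (simp add: v_def star_poly_add h q)
    have "star_poly v * v = h * h + s * s"
      unfolding star_v by (simp add: v_def algebra_simps q)
    then have v2: "(p v)\<^sup>2 \<le> 1 + e"
      using cstar[of v] le_add_diff[of "h * h + s * s" 1] one_le by (simp add: e_def)
    have "v * v + star_poly v * star_poly v = scale_poly 2 (h * h - s * s)"
    proof -
      have "scale_poly 2 (h * h - s * s) = (h * h - s * s) + (h * h - s * s)"
        by (rule poly_mapping_eqI) (simp add: lookup_add)
      then show ?thesis
        unfolding star_v by (simp add: v_def algebra_simps q)
    qed
    then have "2 * p (h * h - s * s) = p (v * v + star_poly v * star_poly v)"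
      by (simp add: scale)
    also have "\<dots> \<le> p v * p v + p (star_poly v) * p (star_poly v)"
      using triangle submult by (meson add_mono order_trans)
    finally have "p (h * h - s * s) \<le> 1 + e"
      using v2 by (simp add: power2_eq_square)
    \<comment> \<open>The defect contributes \<open>e\<close> and the real part 1 + e, so the excess
      over 1 is at most 2 e.\<close>
    moreover have "1 - h * h - h * h = - (h * h + s * s - 1) - (h * h - s * s)"
      by simp
    ultimately show ?thesis
      using triangle_diff[of "- (h * h + s * s - 1)" "h * h - s * s"] e
        diff_commute[of "h * h + s * s" 1] by (simp add: e_def)
  qed
  have "(\<lambda>k. 1 + 4 * r ^ Suc k) \<longlonglongrightarrow> 1 + 4 * 0"
    by (intro tendsto_intros LIMSEQ_Suc LIMSEQ_power_zero) (use \<open>0 \<le> r\<close> r in auto)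
  then show ?thesis
    using bound by (intro LIMSEQ_le_const[of "\<lambda>k. 1 + 4 * r ^ Suc k" 1]) auto
qed

text \<open>The iteration converges geometrically only for r < 1. Shrinking \<open>h\<close> by sqrt
  (1 - t) reaches that case and changes the element by at most 2 t.\<close>

lemma cos_double_le:
  assumes h: "star_poly h = h" and "p h \<le> 1"
  shows "p (1 - h * h - h * h) \<le> 1"
proof (rule field_le_epsilon)
  have hh: "p (h * h) \<le> 1"
    using selfadjoint_square[OF h] assms(2) by (simp add: power_le_one)
  fix e :: real assume "0 < e"
  define t where "t = min (e / 2) (1 / 2)"
  have t: "0 < t" "t < 1" "2 * t \<le> e" using \<open>0 < e\<close> by (auto simp: t_def)
  define g where "g = scale_poly (complex_of_real (sqrt (1 - t))) h"
  have gg: "g * g = scale_poly (1 - complex_of_real t) (h * h)"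
    using t by (simp add: g_def scale_poly_mult_left scale_poly_mult_right flip: of_real_mult)
  have "p (1 - g * g - g * g) \<le> 1"
  proof (rule cos_double_le_strict)
    show "star_poly g = g"
      by (simp add: g_def star_poly_scale h)
    have "cmod (1 - complex_of_real t) = 1 - t"
      using t by (metis abs_of_pos diff_gt_0_iff_gt norm_of_real of_real_1 of_real_diff)
    then show "p (g * g) \<le> 1 - t"
      using hh t by (simp add: gg scale mult_left_le)
    show "1 - t < 1" using t by simp
  qed
  moreover have "1 - h * h - h * h - (1 - g * g - g * g) = scale_poly (- 2 * t) (h * h)"
    unfolding gg by (rule poly_mapping_eqI) (simp add: lookup_add lookup_minus algebra_simps)
  moreover have "p (scale_poly (- 2 * t) (h * h)) \<le> 2 * t"
    using t hh by (simp add: scale norm_mult mult_left_le)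
  ultimately show "p (1 - h * h - h * h) \<le> 1 + e"
    using le_add_diff[of "1 - h * h - h * h" "1 - g * g - g * g"] t by simp
qed

text \<open>1 - h^2 is the average of 1 and 1 - 2 h^2, both of norm at most 1.\<close>

lemma one_minus_square_le:
  assumes h: "star_poly h = h" and "p h \<le> 1"
  shows "p (1 - h * h) \<le> 1"
proof -
  have "scale_poly 2 (1 - h * h) = 1 + (1 - h * h - h * h)"
    by (rule poly_mapping_eqI) (simp add: lookup_add lookup_minus)
  then have "2 * p (1 - h * h) = p (1 + (1 - h * h - h * h))"
    using scale[of 2 "1 - h * h"] by simp
  then show ?thesis
    using triangle[of 1 "1 - h * h - h * h"] one_le cos_double_le[OF assms] by simp
qed

text \<open>
  For \<open>b = h\<^sup>2\<close> and \<open>g = 1 - 2 b\<close> one has \<open>4 b (1 - b) = 1 - g\<^sup>2\<close>, so \<open>h - h\<^sup>3\<close> has norm at most \<open>1 / 2\<close>.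
\<close>

lemma cubic_le:
  assumes h: "star_poly h = h" and "p h \<le> 1"
  shows "p (h * (1 - h * h)) \<le> 1 / 2"
proof -
  define g where "g = 1 - h * h - h * h"
  let ?w = "h * (1 - h * h)"
  \<comment> \<open>The preceding bounds apply once more, with \<open>g\<close> in the role of
    \<open>h\<close>.\<close>
  have "star_poly g = g" "p g \<le> 1"
    using cos_double_le[OF assms] by (simp_all add: g_def star_poly_diff star_poly_mult h)
  then have "p (1 - g * g) \<le> 1"
    by (rule one_minus_square_le)
  moreover have "1 - g * g = scale_poly 4 (h * h - h * h * (h * h))"
  proof -
    have "scale_poly 4 x = x + x + x + x" for x
      by (rule poly_mapping_eqI) (simp add: lookup_add)
    from this[of "h * h - h * h * (h * h)"] show ?thesis
      by (simp add: g_def algebra_simps)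
  qed
  ultimately have b: "p (h * h - h * h * (h * h)) \<le> 1 / 4"
    by (simp add: scale)
  have w: "star_poly ?w = ?w"
    by (simp add: star_poly_diff star_poly_mult h algebra_simps)
  \<comment> \<open>The square of \<open>?w\<close> splits into factors of norm at most 1 and 1 /
    4.\<close>
  have "?w * ?w = (1 - h * h) * (h * h - h * h * (h * h))"
    by (simp add: algebra_simps)
  then have "(p ?w)\<^sup>2 \<le> p (1 - h * h) * p (h * h - h * h * (h * h))"
    using selfadjoint_square[OF w] submult by metis
  also have "\<dots> \<le> 1 * (1 / 4)"
    by (intro mult_mono b one_minus_square_le assms) auto
  finally have "(p ?w)\<^sup>2 \<le> (1 / 2)\<^sup>2"
    by (simp add: power2_eq_square)
  then show ?thesis
    by (rule power2_le_imp_le) simp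
qed

end

text \<open>On singular values this acts as t \<mapsto> t - t^5 / m^4. Being a *-polynomial, it
  stays inside the free algebra, unlike a cut-off of the singular values.\<close>

definition damp :: "real \<Rightarrow> 'g star_poly \<Rightarrow> 'g star_poly" where
  "damp m x = x - scale_poly (1 / complex_of_real m ^ 4) (x * (star_poly x * x * (star_poly x * x)))"

lemma damp_scale:
  fixes x :: "'g star_poly"
  assumes "m > 0"
  defines "z \<equiv> scale_poly (1 / complex_of_real m) x"
  shows "damp m x = scale_poly (complex_of_real m) (z * (1 - star_poly z * z * (star_poly z * z)))"
  using assms(1)
  by (simp add: damp_def z_def star_poly_scale scale_poly_mult_left scale_poly_mult_right
      right_diff_distrib scale_poly_diff power4_eq_xxxx mult.assoc)

section \<open>Effect of damping on a seminorm\<close>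

context cstar_seminormed
begin

text \<open>For y = z (1 - h^2), the product of \<open>star_poly y\<close> and y is (1 - h^2) h (1 -
  h^2), of norm at most 1 / 2 by \<open>cubic_le\<close>. So y has norm at most sqrt (1 / 2) < 3 /
  4.\<close>

lemma damp_one_le:
  assumes "p z \<le> 1"
  defines "h \<equiv> star_poly z * z"
  shows "p (1 - h * h) \<le> 1" "p (z * (1 - h * h)) \<le> 3 / 4"
proof -
  have h: "star_poly h = h" by (simp add: h_def star_poly_mult)
  have "p h \<le> 1"
    unfolding h_def cstar using assms(1) by (simp add: power_le_one)
  note le = one_minus_square_le[OF h this] cubic_le[OF h this]
  show "p (1 - h * h) \<le> 1" by (fact le)
  let ?y = "z * (1 - h * h)"
  have "star_poly ?y * ?y = (1 - h * h) * (h * (1 - h * h))"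
    by (simp add: star_poly_mult star_poly_diff h) (simp add: h_def mult.assoc)
  then have "(p ?y)\<^sup>2 \<le> p (1 - h * h) * p (h * (1 - h * h))"
    using cstar[of ?y] submult by metis
  also have "\<dots> \<le> 1 * (1 / 2)"
    by (intro mult_mono le) auto
  also have "\<dots> \<le> (3 / 4)\<^sup>2"
    by (simp add: power2_eq_square)
  finally show "p ?y \<le> 3 / 4"
    by (rule power2_le_imp_le) simp
qed

text \<open>The first bound serves the source seminorm, which has to shrink; the second keeps the
  target seminorm below 1 during the iteration.\<close>

lemma damp_le:
  assumes "m > 0" "p x \<le> m"
  shows "p (damp m x) \<le> 3 / 4 * m" "p (damp m x) \<le> p x"
proof -
  define z where "z = scale_poly (1 / complex_of_real m) x"
  define w where "w = 1 - star_poly z * z * (star_poly z * z)"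
  have pz: "p z = p x / m" and z: "p z \<le> 1"
    using assms by (simp_all add: z_def scale norm_divide)
  have eq: "p (damp m x) = m * p (z * w)"
    using damp_scale[OF assms(1), of x] assms(1) by (simp add: z_def w_def scale)
  show "p (damp m x) \<le> 3 / 4 * m"
    using damp_one_le(2)[OF z] assms(1) by (simp add: eq w_def)
  have "p (z * w) \<le> p z * 1"
    using submult[of z w] mult_left_mono[OF damp_one_le(1)[OF z], of "p z"]
    by (simp add: w_def)
  then show "p (damp m x) \<le> p x"
    using assms(1) by (simp add: eq pz field_simps)
qed

text \<open>The correction is of degree five in \<open>x\<close> with coefficient 1 / m^4. For
  geometrically growing \<open>m\<close> these errors are summable.\<close>

lemma damp_diff_le:
  assumes "m > 0" "p x \<le> 1"
  shows "p (x - damp m x) \<le> 1 / m ^ 4"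
proof -
  let ?h = "star_poly x * x"
  have h: "p ?h \<le> 1"
    unfolding cstar using assms by (simp add: power_le_one)
  have "p (?h * ?h) \<le> 1"
    using submult[of ?h ?h] mult_le_one[OF h nonneg h] by linarith
  then have "p (x * (?h * ?h)) \<le> 1"
    using submult[of x "?h * ?h"] mult_le_one[OF assms(2) nonneg, of "?h * ?h"] by linarith
  then have "p (x * (?h * ?h)) / m ^ 4 \<le> 1 / m ^ 4"
    using assms(1) by (intro divide_right_mono) auto
  then show ?thesis
    using assms(1) by (simp add: damp_def scale norm_divide norm_power)
qed

section \<open>Sequences converging at a geometric rate\<close>

lemma tendsto_0_squeeze:
  assumes "g \<longlonglongrightarrow> 0" "\<And>k. p (f k) \<le> g k"
  shows "(\<lambda>k. p (f k)) \<longlonglongrightarrow> 0"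
  by (rule tendsto_sandwich[OF _ _ tendsto_const assms(1)]) (simp_all add: assms(2))

lemma Cauchy_geometric:
  assumes "\<And>k. p (s (Suc k) - s k) \<le> C * (1 / 2) ^ k" "0 < e"
  shows "\<exists>N. \<forall>m\<ge>N. \<forall>k\<ge>N. p (s m - s k) < e"
proof -
  have "0 \<le> C" using assms(1)[of 0] order_trans[OF nonneg] by fastforce
  \<comment> \<open>The exact partial geometric sum is kept, as the plain bound 2 C (1 / 2)^N would
    not survive the induction on m.\<close>
  have tail: "p (s (N + m) - s N) \<le> 2 * C * (1 / 2) ^ N * (1 - (1 / 2) ^ m)" for N m
  proof (induction m)
    case (Suc m)
    then show ?case
      using triangle_mid[of "s (N + Suc m)" "s N" "s (N + m)"] assms(1)[of "N + m"]
      by (simp add: power_add algebra_simps)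
  qed simp
  have tail': "p (s (N + m) - s N) \<le> 2 * C * (1 / 2) ^ N" for N m
  proof -
    have "2 * C * (1 / 2) ^ N * (1 - (1 / 2) ^ m) \<le> 2 * C * (1 / 2) ^ N"
      using \<open>0 \<le> C\<close> by (intro mult_left_le) auto
    then show ?thesis using tail[of N m] by linarith
  qed
  \<comment> \<open>The 4 arises because both indices are compared with \<open>N\<close>, at a cost
    of 2 C (1 / 2)^N each.\<close>
  have "(\<lambda>N. 4 * C * (1 / 2) ^ N) \<longlonglongrightarrow> 4 * C * 0"
    by (intro tendsto_intros LIMSEQ_power_zero) auto
  then have "\<forall>\<^sub>F N in sequentially. 4 * C * (1 / 2) ^ N < e"
    using assms(2) by (intro order_tendstoD(2)) auto
  then obtain N where N: "4 * C * (1 / 2) ^ N < e"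
    by (auto simp: eventually_sequentially)
  have "p (s m - s k) < e" if "m \<ge> N" "k \<ge> N" for m k
    using triangle_mid[of "s m" "s k" "s N"] tail'[of N "m - N"] tail'[of N "k - N"] that N
      diff_commute[of "s k" "s N"] by simp
  then show ?thesis by blast
qed

lemma geometric_subseq:
  assumes "\<And>e. e > 0 \<Longrightarrow> \<exists>N. \<forall>m\<ge>N. \<forall>k\<ge>N. p (x m - x k) < e"
  shows "\<exists>\<sigma> :: nat \<Rightarrow> nat. (\<forall>k. \<forall>m\<ge>\<sigma> k. p (x m - x (\<sigma> k)) < (1 / 2) ^ k) \<and> strict_mono \<sigma>"
proof -
  define P where "P k N \<longleftrightarrow> (\<forall>m\<ge>N. \<forall>l\<ge>N. p (x m - x l) < (1 / 2) ^ k)" for k N :: nat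
  have ex: "\<exists>N. P k N" for k
    using assms[of "(1 / 2) ^ k"] by (simp add: P_def)
  have "\<exists>\<sigma>. \<forall>k. P k (\<sigma> k) \<and> \<sigma> k < \<sigma> (Suc k)"
  proof (rule dependent_nat_choice)
    fix N k
    obtain N' where "P (Suc k) N'" using ex by blast
    \<comment> \<open>Any larger threshold works too; \<open>Suc N\<close> enforces strict
      growth.\<close>
    then have "P (Suc k) (max N' (Suc N))" by (simp add: P_def)
    then show "\<exists>M. P (Suc k) M \<and> N < M"
      by (intro exI[of _ "max N' (Suc N)"]) auto
  qed (use ex in auto)
  then show ?thesis
    by (auto simp: P_def strict_mono_Suc_iff)
qed

end

section \<open>Approximate lifts between two seminorms\<close>

text \<open>
  Repeated damping brings the norm with respect to \<open>q\<close> down to a constant, while the elements stay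
  almost unchanged with respect to \<open>p\<close>. This replaces the usual argument that the image of a
  *-homomorphism is closed, which needs quotients of C*-algebras.
\<close>

locale cstar_seminorm_pair = q: cstar_seminormed q + p: cstar_seminormed p
  for q p :: "'g star_poly \<Rightarrow> real"
begin

text \<open>One damping, with \<open>m\<close> the current bound on \<open>q x\<close>, lowers the
  exponent by one. The error allowance grows by (1 / 2)^(K + 1) / 4 in that step, which exceeds the
  cost 1 / m^4 and never reaches 1 / 4 in total.\<close>

lemma approx_lift_power:
  assumes "q x \<le> 2 * (4 / 3) ^ K" "p x \<le> 1"
  shows "\<exists>y. q y \<le> 2 \<and> p (x - y) \<le> (1 - (1 / 2) ^ K) / 4"
  using assms
proof (induction K arbitrary: x)
  case 0
  then show ?case by (intro exI[of _ x]) simp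
next
  case (Suc K)
  define m :: real where "m = 2 * (4 / 3) ^ Suc K"
  have "1 \<le> (4 / 3 :: real) ^ Suc K"
    by (rule one_le_power) simp
  then have m: "0 < m" "1 \<le> m"
    unfolding m_def by linarith+
  have "q (damp m x) \<le> 2 * (4 / 3) ^ K"
    using q.damp_le(1)[of m x] m Suc.prems by (simp add: m_def)
  moreover have "p (damp m x) \<le> 1"
    using p.damp_le(2)[of m x] m Suc.prems by simp
  ultimately obtain y where y: "q y \<le> 2" "p (damp m x - y) \<le> (1 - (1 / 2) ^ K) / 4"
    using Suc.IH by blast
  \<comment> \<open>The 1 / 16 comes from the factor 2 in \<open>m\<close>, and 81 / 256 = (3 / 4)^4
    is below 1 / 2.\<close>
  have "1 / m ^ 4 = 1 / 16 * (81 / 256) ^ Suc K"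
    by (simp add: m_def power_mult_distrib power_divide flip: power_mult)
      (simp add: power_mult mult.commute[of K] power4_eq_xxxx)
  also have "\<dots> \<le> 1 / 16 * (1 / 2) ^ Suc K"
    by (intro mult_left_mono power_mono) auto
  finally have "p (x - damp m x) \<le> (1 / 2) ^ Suc K / 16"
    using p.damp_diff_le[of m x] m Suc.prems by simp
  then have "p (x - y) \<le> (1 / 2) ^ Suc K / 16 + (1 - (1 / 2) ^ K) / 4"
    using p.triangle_mid[of x y "damp m x"] y by linarith
  also have "\<dots> \<le> (1 - (1 / 2) ^ Suc K) / 4"
    by (simp add: field_simps)
  finally show ?case using y by blast
qed

text \<open>By rescaling, the lift has \<open>q\<close>-norm controlled by \<open>t\<close> alone,
  however large \<open>q x\<close> is; \<open>q x\<close> only determines the number of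
  dampings.\<close>

lemma approx_lift:
  assumes "p x \<le> t" "0 < t"
  shows "\<exists>y. q y \<le> 2 * t \<and> p (x - y) \<le> t / 4"
proof -
  define z where "z = scale_poly (1 / complex_of_real t) x"
  have x: "x = scale_poly (complex_of_real t) z"
    using assms by (simp add: z_def)
  have pz: "p z \<le> 1"
    using assms by (simp add: z_def p.scale norm_divide)
  obtain K where "q z < (4 / 3) ^ K"
    using real_arch_pow[of "4 / 3" "q z"] by auto
  then have "q z \<le> 2 * (4 / 3) ^ K"
    using q.nonneg[of z] by linarith
  then obtain y where y: "q y \<le> 2" "p (z - y) \<le> (1 - (1 / 2) ^ K) / 4"
    using approx_lift_power pz by blast
  have "(1 - (1 / 2 :: real) ^ K) / 4 \<le> 1 / 4"
    by simp
  with y have "p (z - y) \<le> 1 / 4"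
    by linarith
  then show ?thesis
    using y assms(2)
    by (intro exI[of _ "scale_poly (complex_of_real t) y"])
      (simp add: x p.scale q.scale flip: scale_poly_diff)
qed

text \<open>Each step adds to \<open>s\<close> an approximate lift of the remaining error. A quarter
  of the allowance 4 (1 / 2)^k is left over and the move to the next \<open>x\<close> adds (1 /
  2)^k, together the next allowance.\<close>

lemma approx_lift_seq:
  assumes "\<And>k. p (x (Suc k) - x k) \<le> (1 / 2) ^ k"
  shows "\<exists>s. \<forall>k. p (x k - s k) \<le> 4 * (1 / 2) ^ k \<and> q (s (Suc k) - s k) \<le> 8 * (1 / 2) ^ k"
proof (rule dependent_nat_choice)
  show "\<exists>s. p (x 0 - s) \<le> 4 * (1 / 2) ^ 0"
    by (intro exI[of _ "x 0"]) simp
next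
  fix s k
  assume "p (x k - s) \<le> 4 * (1 / 2) ^ k"
  then obtain y where y: "q y \<le> 2 * (4 * (1 / 2) ^ k)" "p (x k - s - y) \<le> 4 * (1 / 2) ^ k / 4"
    using approx_lift[of "x k - s" "4 * (1 / 2) ^ k"] by auto
  have "p (x (Suc k) - (s + y)) \<le> p (x (Suc k) - x k) + p (x k - (s + y))"
    by (rule p.triangle_mid)
  then have "p (x (Suc k) - (s + y)) \<le> 4 * (1 / 2) ^ Suc k"
    using assms[of k] y(2) by (simp add: diff_diff_eq)
  then show "\<exists>s'. p (x (Suc k) - s') \<le> 4 * (1 / 2) ^ Suc k \<and> q (s' - s) \<le> 8 * (1 / 2) ^ k"
    using y(1) by (intro exI[of _ "s + y"]) simp
qed

end

section \<open>The universal seminorm\<close>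

text \<open>A pointwise supremum of C*-seminorms is one again: boundedness makes \<open>SUP\<close>
  an upper bound, and the zero seminorm makes the family nonempty.\<close>

lemma cstar_seminorm_univ_seminorm:
  assumes bdd: "\<And>x. bdd_above ((\<lambda>p. p x) ` cstar_seminorms R)"
  shows "cstar_seminorm (univ_seminorm R)"
proof -
  have zero: "(\<lambda>_. 0) \<in> cstar_seminorms R"
    by (auto simp: cstar_seminorms_def cstar_seminorm_def)
  have upper: "p x \<le> univ_seminorm R x" if "p \<in> cstar_seminorms R" for p x
    unfolding univ_seminorm_def using that bdd by (intro cSUP_upper)
  have least: "univ_seminorm R x \<le> c" if "\<And>p. p \<in> cstar_seminorms R \<Longrightarrow> p x \<le> c" for x c
    unfolding univ_seminorm_def using that zero by (intro cSUP_least) auto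
  have sn: "cstar_seminormed p" if "p \<in> cstar_seminorms R" for p
    using that by unfold_locales (simp add: cstar_seminorms_def)
  have nonneg: "0 \<le> univ_seminorm R x" for x
    using upper[OF zero] .
  have scale_le: "univ_seminorm R (scale_poly c x) \<le> cmod c * univ_seminorm R x" for c x
    by (rule least) (simp add: cstar_seminormed.scale[OF sn] mult_left_mono upper)
  show ?thesis
    unfolding cstar_seminorm_def
  proof (intro conjI allI)
    fix x y :: "'a star_poly" and c
    show "0 \<le> univ_seminorm R x" by (fact nonneg)
    show "univ_seminorm R (x + y) \<le> univ_seminorm R x + univ_seminorm R y"
      by (rule least) (meson add_mono cstar_seminormed.triangle order_trans sn upper)
    show "univ_seminorm R (x * y) \<le> univ_seminorm R x * univ_seminorm R y"
    proof (rule least)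
      fix p assume p: "p \<in> cstar_seminorms R"
      have "p (x * y) \<le> p x * p y" by (rule cstar_seminormed.submult[OF sn[OF p]])
      also have "\<dots> \<le> univ_seminorm R x * univ_seminorm R y"
        by (intro mult_mono upper p nonneg cstar_seminormed.nonneg[OF sn[OF p]])
      finally show "p (x * y) \<le> univ_seminorm R x * univ_seminorm R y" .
    qed
    show "univ_seminorm R (scale_poly c x) = cmod c * univ_seminorm R x"
    proof (cases "c = 0")
      case True
      then show ?thesis using scale_le[of c x] nonneg[of "scale_poly c x"] by simp
    next
      case False
      \<comment> \<open>The reverse inequality is the one already shown, for the inverse
        scalar.\<close>
      then have "univ_seminorm R x \<le> univ_seminorm R (scale_poly c x) / cmod c"
        using scale_le[of "1 / c" "scale_poly c x"] by (simp add: norm_divide)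
      then show ?thesis
        using False scale_le[of c x] by (simp add: field_simps)
    qed
    show "univ_seminorm R (star_poly x * x) = (univ_seminorm R x)\<^sup>2"
    proof (rule antisym)
      show "univ_seminorm R (star_poly x * x) \<le> (univ_seminorm R x)\<^sup>2"
        by (rule least)
          (simp add: cstar_seminormed.cstar[OF sn] power_mono upper cstar_seminormed.nonneg[OF sn])
      \<comment> \<open>Taking the root first makes the bound independent of the individual
        seminorm, so the supremum can be formed before squaring.\<close>
      have "univ_seminorm R x \<le> sqrt (univ_seminorm R (star_poly x * x))"
        by (rule least) (metis cstar_seminormed.cstar real_le_rsqrt sn upper)
      then show "(univ_seminorm R x)\<^sup>2 \<le> univ_seminorm R (star_poly x * x)"
        using nonneg real_le_rsqrt by (metis power_mono real_sqrt_pow2)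
    qed
  qed
qed

lemma univ_seminorm_mono:
  assumes "\<And>x. bdd_above ((\<lambda>p. p x) ` cstar_seminorms R)"
    and "cstar_seminorms S \<subseteq> cstar_seminorms R"
  shows "univ_seminorm S x \<le> univ_seminorm R x"
proof -
  have "(\<lambda>_. 0) \<in> cstar_seminorms S"
    by (auto simp: cstar_seminorms_def cstar_seminorm_def)
  then show ?thesis
    unfolding univ_seminorm_def using assms by (intro cSUP_subset_mono) auto
qed

section \<open>The completion\<close>

locale univ_cstar_rels =
  fixes R :: "('g star_poly \<times> 'g star_poly) set"
  assumes cstar_seminorm_univ: "cstar_seminorm (univ_seminorm R)"
begin

sublocale cstar_seminormed "univ_seminorm R"
  by unfold_locales (fact cstar_seminorm_univ)

abbreviation N :: "'g star_poly \<Rightarrow> real" where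
  "N \<equiv> univ_seminorm R"

lemma cauchy_seqs_iff:
  "x \<in> cauchy_seqs R \<longleftrightarrow> (\<forall>e>0. \<exists>M. \<forall>m\<ge>M. \<forall>k\<ge>M. N (x m - x k) < e)"
  by (simp add: cauchy_seqs_def)

lemma equiv_cauchy_rel: "equiv (cauchy_seqs R) (cauchy_rel R)"
proof (rule equivI)
  show "cauchy_rel R \<subseteq> cauchy_seqs R \<times> cauchy_seqs R" "refl_on (cauchy_seqs R) (cauchy_rel R)"
    by (auto simp: cauchy_rel_def refl_on_def)
  show "sym (cauchy_rel R)"
    by (auto simp: cauchy_rel_def sym_def diff_commute)
  show "trans (cauchy_rel R)"
  proof (rule transI)
    fix x y z assume xyz: "(x, y) \<in> cauchy_rel R" "(y, z) \<in> cauchy_rel R"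
    then have "(\<lambda>k. N (x k - y k) + N (y k - z k)) \<longlonglongrightarrow> 0"
      by (intro tendsto_add_zero) (auto simp: cauchy_rel_def)
    then have "(\<lambda>k. N (x k - z k)) \<longlonglongrightarrow> 0"
      by (rule tendsto_0_squeeze) (rule triangle_mid)
    with xyz show "(x, z) \<in> cauchy_rel R" by (auto simp: cauchy_rel_def)
  qed
qed

lemma cauchy_class_eqI: "(x, y) \<in> cauchy_rel R \<Longrightarrow> cauchy_class R x = cauchy_class R y"
  unfolding cauchy_class_def by (rule equiv_class_eq[OF equiv_cauchy_rel])

lemma carrier_iff:
  "X \<in> carrier (univ_cstar R) \<longleftrightarrow> (\<exists>x\<in>cauchy_seqs R. X = cauchy_class R x)"
  by (auto simp: univ_cstar_def cauchy_class_def quotient_def)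

lemma cauchy_class_in_carrier [simp]:
  "x \<in> cauchy_seqs R \<Longrightarrow> cauchy_class R x \<in> carrier (univ_cstar R)"
  using carrier_iff by blast

text \<open>The operations of \<open>univ_cstar\<close> use chosen representatives; this lets any
  other representative replace them.\<close>

lemma cauchy_rep_rel:
  assumes "x \<in> cauchy_seqs R"
  shows "(x, cauchy_rep (cauchy_class R x)) \<in> cauchy_rel R"
proof -
  have "x \<in> cauchy_class R x"
    unfolding cauchy_class_def by (rule equiv_class_self[OF equiv_cauchy_rel assms])
  then have "cauchy_rep (cauchy_class R x) \<in> cauchy_class R x"
    unfolding cauchy_rep_def by (rule someI[where P = "\<lambda>y. y \<in> cauchy_class R x"])
  then show ?thesis by (simp add: cauchy_class_def)
qed

lemma const_in_cauchy_seqs [simp]: "(\<lambda>k. a) \<in> cauchy_seqs R"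
  by (auto simp: cauchy_seqs_iff)

lemma cauchy_seqs_bounded:
  assumes "x \<in> cauchy_seqs R"
  shows "\<exists>b. \<forall>k. N (x k) \<le> b"
proof -
  obtain M where M: "\<forall>m\<ge>M. \<forall>k\<ge>M. N (x m - x k) < 1"
    using assms by (force simp: cauchy_seqs_iff)
  have "N (x k) \<le> Max ((\<lambda>k. N (x k)) ` {..M}) + 1" for k
  proof (cases "k \<le> M")
    case True
    then have "N (x k) \<le> Max ((\<lambda>k. N (x k)) ` {..M})" by simp
    then show ?thesis by linarith
  next
    case False
    then have "N (x k - x M) < 1" using M by simp
    moreover have "N (x M) \<le> Max ((\<lambda>k. N (x k)) ` {..M})" by simp
    ultimately show ?thesis
      using le_add_diff[of "x k" "x M"] by linarith
  qed
  then show ?thesis by blast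
qed

text \<open>All operations of the completion are instances of a binary operation as below.\<close>

definition locally_lipschitz :: "('g star_poly \<Rightarrow> 'g star_poly \<Rightarrow> 'g star_poly) \<Rightarrow> bool" where
  "locally_lipschitz f \<longleftrightarrow> (\<forall>b. \<exists>L. \<forall>x y x' y'. N x \<le> b \<longrightarrow> N y \<le> b \<longrightarrow> N x' \<le> b \<longrightarrow> N y' \<le> b \<longrightarrow>
     N (f x y - f x' y') \<le> L * N (x - x') + L * N (y - y'))"

text \<open>One constant works along whole sequences since Cauchy sequences are bounded. Separate
  indices \<open>k\<close> and \<open>l\<close> serve both uses: Cauchyness compares different
  indices of one sequence, equivalence equal indices of two.\<close>

lemma locally_lipschitz_seqE:
  assumes "locally_lipschitz f"
    and C: "x \<in> cauchy_seqs R" "y \<in> cauchy_seqs R" "x' \<in> cauchy_seqs R" "y' \<in> cauchy_seqs R"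
  obtains L where "0 < L"
    "\<And>k l. N (f (x k) (y k) - f (x' l) (y' l)) \<le> L * (N (x k - x' l) + N (y k - y' l))"
proof -
  obtain b1 b2 b3 b4 where b: "\<And>k. N (x k) \<le> b1" "\<And>k. N (y k) \<le> b2"
    "\<And>k. N (x' k) \<le> b3" "\<And>k. N (y' k) \<le> b4"
    using C cauchy_seqs_bounded by metis
  define b where "b = max (max b1 b2) (max b3 b4)"
  obtain L where L: "N v \<le> b \<Longrightarrow> N w \<le> b \<Longrightarrow> N v' \<le> b \<Longrightarrow> N w' \<le> b \<Longrightarrow>
      N (f v w - f v' w') \<le> L * N (v - v') + L * N (w - w')" for v w v' w'
    using assms(1) unfolding locally_lipschitz_def by meson
  show ?thesis
  \<comment> \<open>The maximum with 1 makes the constant positive, so that it can be divided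
    by.\<close>
  proof (rule that[of "max L 1"])
    fix k l
    have "N (f (x k) (y k) - f (x' l) (y' l)) \<le> L * N (x k - x' l) + L * N (y k - y' l)"
      by (rule L) (use b in \<open>simp_all add: b_def le_max_iff_disj\<close>)
    also have "\<dots> \<le> max L 1 * N (x k - x' l) + max L 1 * N (y k - y' l)"
      by (intro add_mono mult_right_mono) auto
    finally show "N (f (x k) (y k) - f (x' l) (y' l)) \<le> max L 1 * (N (x k - x' l) + N (y k - y' l))"
      by (simp add: distrib_left)
  qed simp
qed

lemma locally_lipschitz_cauchy_seqs:
  assumes f: "locally_lipschitz f" and xy: "x \<in> cauchy_seqs R" "y \<in> cauchy_seqs R"
  shows "(\<lambda>k. f (x k) (y k)) \<in> cauchy_seqs R"
  unfolding cauchy_seqs_iff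
proof (intro allI impI)
  obtain L where L: "0 < L"
    "\<And>k l. N (f (x k) (y k) - f (x l) (y l)) \<le> L * (N (x k - x l) + N (y k - y l))"
    by (rule locally_lipschitz_seqE[OF f xy xy]) blast
  fix e :: real assume "0 < e"
  then have e: "0 < e / (2 * L)" using L(1) by simp
  obtain M1 M2 where M: "\<forall>m\<ge>M1. \<forall>k\<ge>M1. N (x m - x k) < e / (2 * L)"
    "\<forall>m\<ge>M2. \<forall>k\<ge>M2. N (y m - y k) < e / (2 * L)"
    using xy e unfolding cauchy_seqs_iff by metis
  have "N (f (x m) (y m) - f (x k) (y k)) < e" if "m \<ge> max M1 M2" "k \<ge> max M1 M2" for m k
  proof -
    have "N (x m - x k) + N (y m - y k) < e / (2 * L) + e / (2 * L)"
      using M that by (intro add_strict_mono) auto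
    also have "\<dots> = e / L" by simp
    finally show ?thesis
      using L(1) L(2)[of m k] by (simp add: field_simps)
  qed
  then show "\<exists>M. \<forall>m\<ge>M. \<forall>k\<ge>M. N (f (x m) (y m) - f (x k) (y k)) < e"
    by blast
qed

lemma locally_lipschitz_cauchy_rel:
  assumes f: "locally_lipschitz f"
    and xx': "(x, x') \<in> cauchy_rel R" and yy': "(y, y') \<in> cauchy_rel R"
  shows "(\<lambda>k. f (x k) (y k), \<lambda>k. f (x' k) (y' k)) \<in> cauchy_rel R"
proof -
  have C: "x \<in> cauchy_seqs R" "y \<in> cauchy_seqs R" "x' \<in> cauchy_seqs R" "y' \<in> cauchy_seqs R"
    using xx' yy' by (auto simp: cauchy_rel_def)
  obtain L where L: "0 < L"
    "\<And>k. N (f (x k) (y k) - f (x' k) (y' k)) \<le> L * (N (x k - x' k) + N (y k - y' k))"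
    by (rule locally_lipschitz_seqE[OF f C]) blast
  have "(\<lambda>k. L * (N (x k - x' k) + N (y k - y' k))) \<longlonglongrightarrow> 0"
    using xx' yy' by (intro tendsto_mult_right_zero tendsto_add_zero) (auto simp: cauchy_rel_def)
  then have "(\<lambda>k. N (f (x k) (y k) - f (x' k) (y' k))) \<longlonglongrightarrow> 0"
    by (rule tendsto_0_squeeze) (rule L(2))
  then show ?thesis
    using C locally_lipschitz_cauchy_seqs[OF f] by (simp add: cauchy_rel_def)
qed

lemma locally_lipschitz_class:
  assumes "locally_lipschitz f" "x \<in> cauchy_seqs R" "y \<in> cauchy_seqs R"
  shows "cauchy_class R (\<lambda>k. f (cauchy_rep (cauchy_class R x) k) (cauchy_rep (cauchy_class R y) k))
    = cauchy_class R (\<lambda>k. f (x k) (y k))"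
  by (rule cauchy_class_eqI[OF locally_lipschitz_cauchy_rel[OF assms(1)
        cauchy_rep_rel[OF assms(2)] cauchy_rep_rel[OF assms(3)]], symmetric])

lemma locally_lipschitz_add: "locally_lipschitz (+)"
  unfolding locally_lipschitz_def
  by (intro allI exI[of _ 1]) (metis add_diff_add mult_1 triangle)

lemma locally_lipschitz_mult: "locally_lipschitz (*)"
  unfolding locally_lipschitz_def
proof (intro allI exI impI)
  fix b x y x' y' assume b: "N x \<le> b" "N y \<le> b" "N x' \<le> b" "N y' \<le> b"
  have "N (x * y - x' * y') \<le> N (x - x') * N y + N x' * N (y - y')"
    by (rule mult_diff_le)
  also have "\<dots> \<le> N (x - x') * b + b * N (y - y')"
    using b by (intro add_mono mult_left_mono mult_right_mono) auto
  finally show "N (x * y - x' * y') \<le> b * N (x - x') + b * N (y - y')"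
    by (simp add: mult.commute)
qed

lemma locally_lipschitz_scale: "locally_lipschitz (\<lambda>x y. scale_poly c x)"
  unfolding locally_lipschitz_def
  by (intro allI exI[of _ "cmod c"]) (simp add: scale flip: scale_poly_diff)

lemma locally_lipschitz_star: "locally_lipschitz (\<lambda>x y. star_poly x)"
  unfolding locally_lipschitz_def
  by (intro allI exI[of _ 1]) (simp flip: star_poly_diff)

lemmas cauchy_seqs_intros =
  locally_lipschitz_cauchy_seqs[OF locally_lipschitz_add]
  locally_lipschitz_cauchy_seqs[OF locally_lipschitz_mult]
  locally_lipschitz_cauchy_seqs[OF locally_lipschitz_scale]
  locally_lipschitz_cauchy_seqs[OF locally_lipschitz_star]

lemma univ_cstar_class:
  assumes "x \<in> cauchy_seqs R" "y \<in> cauchy_seqs R"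
  shows "cauchy_class R x \<oplus>\<^bsub>univ_cstar R\<^esub> cauchy_class R y = cauchy_class R (\<lambda>k. x k + y k)"
    and "cauchy_class R x \<otimes>\<^bsub>univ_cstar R\<^esub> cauchy_class R y = cauchy_class R (\<lambda>k. x k * y k)"
  using locally_lipschitz_class[OF locally_lipschitz_add assms]
    locally_lipschitz_class[OF locally_lipschitz_mult assms]
  by (simp_all add: univ_cstar_def)

lemma univ_cstar_class_unary:
  assumes "x \<in> cauchy_seqs R"
  shows "c \<odot>\<^bsub>univ_cstar R\<^esub> cauchy_class R x = cauchy_class R (\<lambda>k. scale_poly c (x k))"
    and "star (univ_cstar R) (cauchy_class R x) = cauchy_class R (\<lambda>k. star_poly (x k))"
  using locally_lipschitz_class[OF locally_lipschitz_scale assms assms]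
    locally_lipschitz_class[OF locally_lipschitz_star assms assms]
  by (simp_all add: univ_cstar_def)

end

section \<open>The homomorphism between two completions and its surjectivity\<close>

locale univ_cstar_dominated = R: univ_cstar_rels R + S: univ_cstar_rels S
  for R S :: "('g star_poly \<times> 'g star_poly) set" +
  assumes dominated: "univ_seminorm S x \<le> univ_seminorm R x"
begin

sublocale cstar_seminorm_pair "univ_seminorm R" "univ_seminorm S" ..

text \<open>Induced by the identity on *-polynomials: sequences that are Cauchy for \<open>R\<close>
  remain so for the smaller seminorm of \<open>S\<close>.\<close>

definition quotient_map :: "(nat \<Rightarrow> 'g star_poly) set \<Rightarrow> (nat \<Rightarrow> 'g star_poly) set" where
  "quotient_map X = cauchy_class S (cauchy_rep X)"

lemma cauchy_seqs_mono: "x \<in> cauchy_seqs R \<Longrightarrow> x \<in> cauchy_seqs S"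
  unfolding R.cauchy_seqs_iff S.cauchy_seqs_iff by (meson dominated le_less_trans)

lemma cauchy_rel_mono: "(x, y) \<in> cauchy_rel R \<Longrightarrow> (x, y) \<in> cauchy_rel S"
  unfolding cauchy_rel_def
  by (auto intro: cauchy_seqs_mono S.tendsto_0_squeeze dominated)

lemma quotient_map_class:
  "x \<in> cauchy_seqs R \<Longrightarrow> quotient_map (cauchy_class R x) = cauchy_class S x"
  unfolding quotient_map_def
  by (rule sym) (intro S.cauchy_class_eqI cauchy_rel_mono R.cauchy_rep_rel)

lemma quotient_map_star_hom: "quotient_map \<in> star_hom (univ_cstar R) (univ_cstar S)"
proof -
  have one: "\<one>\<^bsub>univ_cstar T\<^esub> = cauchy_class T (\<lambda>k. 1)" for T :: "('g star_poly \<times> 'g star_poly) set"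
    by (simp add: univ_cstar_def)
  show ?thesis
    unfolding star_hom_def ring_hom_def
    by (auto simp: R.carrier_iff one quotient_map_class R.univ_cstar_class S.univ_cstar_class
        R.univ_cstar_class_unary S.univ_cstar_class_unary
        R.cauchy_seqs_intros cauchy_seqs_mono)
qed

lemma quotient_map_gen: "quotient_map (univ_gen R g) = univ_gen S g"
  by (simp add: univ_gen_def quotient_map_class)

text \<open>A subsequence with geometric increments is lifted approximately. The lifts are Cauchy
  for \<open>R\<close>, and for \<open>S\<close> they approach the subsequence, which is equivalent
  to \<open>x\<close>.\<close>

lemma cauchy_lift:
  assumes x: "x \<in> cauchy_seqs S"
  shows "\<exists>s\<in>cauchy_seqs R. (s, x) \<in> cauchy_rel S"
proof -
  obtain \<sigma> where \<sigma>: "\<And>k m. m \<ge> \<sigma> k \<Longrightarrow> univ_seminorm S (x m - x (\<sigma> k)) < (1 / 2) ^ k"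
    and mono: "strict_mono \<sigma>"
    using S.geometric_subseq[of x] x unfolding S.cauchy_seqs_iff by blast
  have "univ_seminorm S (x (\<sigma> (Suc k)) - x (\<sigma> k)) \<le> (1 / 2) ^ k" for k
    using \<sigma>[of k "\<sigma> (Suc k)"] mono by (simp add: strict_mono_less_eq less_imp_le)
  then obtain s where s: "\<And>k. univ_seminorm S (x (\<sigma> k) - s k) \<le> 4 * (1 / 2) ^ k"
    "\<And>k. univ_seminorm R (s (Suc k) - s k) \<le> 8 * (1 / 2) ^ k"
    using approx_lift_seq[of "\<lambda>k. x (\<sigma> k)"] by blast
  have sR: "s \<in> cauchy_seqs R"
    unfolding R.cauchy_seqs_iff using R.Cauchy_geometric[OF s(2)] by blast
  have "(\<lambda>k. univ_seminorm S (s k - x k)) \<longlonglongrightarrow> 0"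
  proof (rule LIMSEQ_I)
    fix e :: real assume "0 < e"
    have "(\<lambda>k. 4 * (1 / 2 :: real) ^ k) \<longlonglongrightarrow> 0"
      by (intro tendsto_mult_right_zero LIMSEQ_power_zero) simp
    then have "\<forall>\<^sub>F k in sequentially. 4 * (1 / 2 :: real) ^ k < e / 2"
      by (rule order_tendstoD(2)) (use \<open>0 < e\<close> in simp)
    then obtain M where M: "\<And>k. k \<ge> M \<Longrightarrow> 4 * (1 / 2 :: real) ^ k < e / 2"
      by (auto simp: eventually_sequentially)
    obtain M' where M': "\<And>m k. m \<ge> M' \<Longrightarrow> k \<ge> M' \<Longrightarrow> univ_seminorm S (x m - x k) < e / 2"
      using x \<open>0 < e\<close> unfolding S.cauchy_seqs_iff by (meson half_gt_zero)
    have "univ_seminorm S (s k - x k) < e" if "k \<ge> max M M'" for k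
    proof -
      \<comment> \<open>A strictly increasing index satisfies \<sigma> k \<ge> k.\<close>
      have "\<sigma> k \<ge> M'" using seq_suble[OF mono, of k] that by simp
      then show ?thesis
        using S.triangle_mid[of "s k" "x k" "x (\<sigma> k)"] s(1)[of k] M[of k] M'[of "\<sigma> k" k] that
          S.diff_commute[of "s k" "x (\<sigma> k)"] by simp
    qed
    then show "\<exists>M. \<forall>k\<ge>M. norm (univ_seminorm S (s k - x k) - 0) < e"
      by (intro exI[of _ "max M M'"]) simp
  qed
  then have "(s, x) \<in> cauchy_rel S"
    using x cauchy_seqs_mono[OF sR] by (simp add: cauchy_rel_def)
  with sR show ?thesis by blast
qed

lemma quotient_map_surj:
  "quotient_map ` carrier (univ_cstar R) = carrier (univ_cstar S)"
proof (intro equalityI subsetI)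
  fix X assume "X \<in> carrier (univ_cstar S)"
  then obtain x where "x \<in> cauchy_seqs S" "X = cauchy_class S x"
    using S.carrier_iff by blast
  then obtain s where "s \<in> cauchy_seqs R" "X = cauchy_class S s"
    using cauchy_lift S.cauchy_class_eqI by metis
  then show "X \<in> quotient_map ` carrier (univ_cstar R)"
    by (metis R.cauchy_class_in_carrier image_eqI quotient_map_class)
qed (auto simp: R.carrier_iff quotient_map_class cauchy_seqs_mono)

end


section \<open>Quantum automorphism groups of graphs\<close>

context cstar_seminormed
begin

lemma null_trans: "p (x - y) = 0 \<Longrightarrow> p (y - z) = 0 \<Longrightarrow> p (x - z) = 0"
  using triangle_mid[of x z y] nonneg[of "x - z"] by linarith

lemma null_sym: "p (x - y) = 0 \<Longrightarrow> p (y - x) = 0"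
  by (simp add: diff_commute)

lemma null_mult: "p (x - x') = 0 \<Longrightarrow> p (y - y') = 0 \<Longrightarrow> p (x * y - x' * y') = 0"
  using mult_diff_le[of x y x' y'] nonneg[of "x * y - x' * y'"] by simp

lemma null_sum:
  assumes "\<And>i. i \<in> A \<Longrightarrow> p (f i) = 0"
  shows "p (sum f A) = 0"
  using assms
proof (induction A rule: infinite_finite_induct)
  case (insert a A)
  then show ?case
    using triangle[of "f a" "sum f A"] nonneg[of "f a + sum f A"] by simp
qed simp_all

end

text \<open>The sum relation comes from multiplying the column sums for \<open>k\<close> and
  \<open>l\<close>: as \<open>k\<close> and \<open>l\<close> are adjacent, all products over
  non-adjacent \<open>i\<close> and \<open>j\<close> vanish.\<close>

lemma eps_sym_subset_bichon:
  assumes entries: "\<And>i j. \<epsilon>$i$j \<in> {0, 1}" and sym: "\<And>i j. \<epsilon>$i$j = \<epsilon>$j$i"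
  shows "cstar_seminorms (eps_sym_rels \<epsilon>) \<subseteq> cstar_seminorms (bichon_rels \<epsilon>)"
proof
  fix p assume p: "p \<in> cstar_seminorms (eps_sym_rels \<epsilon>)"
  interpret cstar_seminormed p
    using p by unfold_locales (simp add: cstar_seminorms_def)
  have rel: "p (l - r) = 0" if "(l, r) \<in> eps_sym_rels \<epsilon>" for l r
    using p that by (auto simp: cstar_seminorms_def)
  have magic: "p (l - r) = 0" if "(l, r) \<in> magic_rels" for l r
    using rel that by (simp add: eps_sym_rels_def)
  have zero: "p (u i k * u j l) = 0" if "(\<epsilon>$i$j = 1) \<noteq> (\<epsilon>$k$l = 1)" for i j k l
  proof -
    have "(u i k * u j l, 0) \<in> eps_sym_rels \<epsilon>"
      using that entries[of i j] entries[of k l] unfolding eps_sym_rels_def by blast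
    then show ?thesis using rel by fastforce
  qed
  \<comment> \<open>Exchanging the two factors swaps the indices in both entries of \<epsilon>,
    which symmetry undoes.\<close>
  have zero': "p (u j l * u i k) = 0" if "(\<epsilon>$i$j = 1) \<noteq> (\<epsilon>$k$l = 1)" for i j k l
    using zero[of j i l k] that sym by metis
  have comm: "p (u i k * u j l - u j l * u i k) = 0" if "\<epsilon>$i$j = 1" "\<epsilon>$k$l = 1" for i j k l
    by (rule rel) (use that in \<open>unfold eps_sym_rels_def, blast\<close>)
  have sum: "p ((\<Sum>(i, j)\<in>{(i, j). \<epsilon>$i$j = 1}. u i k * u j l) - 1) = 0" if kl: "\<epsilon>$k$l = 1" for k l
  proof -
    let ?A = "{(i, j). \<epsilon>$i$j = 1}" and ?f = "\<lambda>(i, j). u i k * u j l"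
    have "p ((\<Sum>i\<in>UNIV. u i k) - 1) = 0" "p ((\<Sum>j\<in>UNIV. u j l) - 1) = 0"
      by (intro magic, force simp: magic_rels_def)+
    then have "p ((\<Sum>i\<in>UNIV. u i k) * (\<Sum>j\<in>UNIV. u j l) - 1 * 1) = 0"
      by (rule null_mult)
    then have "p (sum ?f UNIV - 1) = 0"
      by (simp add: sum_product sum.cartesian_product)
    moreover have "sum ?f UNIV - sum ?f ?A = sum ?f (- ?A)"
      by (simp add: Compl_eq_Diff_UNIV sum_diff)
    moreover have "p (sum ?f (- ?A)) = 0"
      by (rule null_sum) (use kl in \<open>auto intro: zero\<close>)
    ultimately show ?thesis
      using null_trans[OF null_sym, of "sum ?f UNIV" "sum ?f ?A" 1] by simp
  qed
  have "p (l - r) = 0" if "(l, r) \<in> bichon_rels \<epsilon>" for l r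
    using that unfolding bichon_rels_def
  proof (elim UnE CollectE exE conjE)
    \<comment> \<open>Both orders of the product are null, so the commutation relation holds
      trivially.\<close>
    fix i j k l' assume "(l, r) = (u i k * u j l', u j l' * u i k)" "(\<epsilon>$i$j = 1) \<noteq> (\<epsilon>$k$l' = 1)"
    then have "p (l - r) \<le> 0"
      using triangle_diff[of l r] zero zero' by simp
    then show ?thesis
      by (simp add: antisym)
  qed (auto simp: magic zero' comm sum[unfolded One_nat_def])
  then show "p \<in> cstar_seminorms (bichon_rels \<epsilon>)"
    using cstar_seminorm by (auto simp: cstar_seminorms_def)
qed

text \<open>\<open>bichon_rels\<close> splits the double equation for mixed adjacency into
  commutation and vanishing of the reversed product; transitivity recovers the vanishing of the
  product itself.\<close>

lemma bichon_subset_eps_sym: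
  "cstar_seminorms (bichon_rels \<epsilon>) \<subseteq> cstar_seminorms (eps_sym_rels \<epsilon>)"
proof
  fix p assume p: "p \<in> cstar_seminorms (bichon_rels \<epsilon>)"
  interpret cstar_seminormed p
    using p by unfold_locales (simp add: cstar_seminorms_def)
  have rel: "p (l - r) = 0" if "(l, r) \<in> bichon_rels \<epsilon>" for l r
    using p that by (auto simp: cstar_seminorms_def)
  have zero: "p (u i k * u j l) = 0" if "(\<epsilon>$i$j = 1) \<noteq> (\<epsilon>$k$l = 1)" for i j k l
  proof -
    have "p (u i k * u j l - u j l * u i k) = 0" "p (u j l * u i k - 0) = 0"
      by (rule rel, use that in \<open>unfold bichon_rels_def, blast\<close>)+
    then show ?thesis
      using null_trans by fastforce
  qed
  have comm: "p (u i k * u j l - u j l * u i k) = 0" if "\<epsilon>$i$j = 1" "\<epsilon>$k$l = 1" for i j k l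
    by (rule rel) (use that in \<open>unfold bichon_rels_def, blast\<close>)
  have "p (l - r) = 0" if "(l, r) \<in> eps_sym_rels \<epsilon>" for l r
    using that rel[of l r] unfolding eps_sym_rels_def
    by (auto simp: zero comm) (simp add: bichon_rels_def)
  then show "p \<in> cstar_seminorms (eps_sym_rels \<epsilon>)"
    using cstar_seminorm by (auto simp: cstar_seminorms_def)
qed

text \<open>
  With \<open>a\<close> and \<open>b\<close> the two sides of a relation of Banica, inserting the row and column sums of the
  magic unitary on the respective other side gives \<open>a = a b = b\<close>, since all other products vanish.
\<close>

lemma eps_sym_subset_banica:
  assumes entries: "\<And>i j. \<epsilon>$i$j \<in> {0, 1}"
  shows "cstar_seminorms (eps_sym_rels \<epsilon>) \<subseteq> cstar_seminorms (banica_rels \<epsilon>)"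
proof
  fix p assume p: "p \<in> cstar_seminorms (eps_sym_rels \<epsilon>)"
  interpret cstar_seminormed p
    using p by unfold_locales (simp add: cstar_seminorms_def)
  have rel: "p (l - r) = 0" if "(l, r) \<in> eps_sym_rels \<epsilon>" for l r
    using p that by (auto simp: cstar_seminorms_def)
  have magic: "p (l - r) = 0" if "(l, r) \<in> magic_rels" for l r
    using rel that by (simp add: eps_sym_rels_def)
  have zero: "p (u i k * u j l) = 0" if "(\<epsilon>$i$j = 1) \<noteq> (\<epsilon>$k$l = 1)" for i j k l
  proof -
    have "(u i k * u j l, 0) \<in> eps_sym_rels \<epsilon>"
      using that entries[of i j] entries[of k l] unfolding eps_sym_rels_def by blast
    then show ?thesis using rel by fastforce
  qed
  have "p ((\<Sum>k\<in>{k. \<epsilon>$k$l = 1}. u i k) - (\<Sum>j\<in>{j. \<epsilon>$i$j = 1}. u j l)) = 0" for i l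
  proof -
    let ?K = "{k. \<epsilon>$k$l = 1}" and ?J = "{j. \<epsilon>$i$j = 1}"
    define a b where "a = (\<Sum>k\<in>?K. u i k)" and "b = (\<Sum>j\<in>?J. u j l)"
    have row: "p ((\<Sum>k\<in>UNIV. u i k) - 1) = 0" and col: "p ((\<Sum>j\<in>UNIV. u j l) - 1) = 0"
      by (intro magic, force simp: magic_rels_def)+
    \<comment> \<open>The surviving terms have \<open>k\<close> adjacent to \<open>l\<close> but
      \<open>j\<close> not adjacent to \<open>i\<close>, so each is null.\<close>
    have "a * (\<Sum>j\<in>UNIV. u j l) - a * b = (\<Sum>k\<in>?K. \<Sum>j\<in>- ?J. u i k * u j l)"
      by (simp add: a_def b_def Compl_eq_Diff_UNIV sum_diff sum_product sum_subtractf flip: right_diff_distrib)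
    moreover have "p (\<Sum>k\<in>?K. \<Sum>j\<in>- ?J. u i k * u j l) = 0"
      by (intro null_sum zero) auto
    moreover have "p (a * (\<Sum>j\<in>UNIV. u j l) - a * 1) = 0"
      by (rule null_mult) (simp_all add: col)
    ultimately have a: "p (a - a * b) = 0"
      using null_trans[OF null_sym, of "a * (\<Sum>j\<in>UNIV. u j l)" a "a * b"] by simp
    \<comment> \<open>Now \<open>j\<close> is adjacent to \<open>i\<close> and \<open>k\<close> is
      not adjacent to \<open>l\<close>.\<close>
    have "(\<Sum>k\<in>UNIV. u i k) * b - a * b = (\<Sum>k\<in>- ?K. \<Sum>j\<in>?J. u i k * u j l)"
      by (simp add: a_def b_def Compl_eq_Diff_UNIV sum_diff sum_product sum_subtractf flip: left_diff_distrib)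
    moreover have "p (\<Sum>k\<in>- ?K. \<Sum>j\<in>?J. u i k * u j l) = 0"
      by (intro null_sum zero) auto
    moreover have "p ((\<Sum>k\<in>UNIV. u i k) * b - 1 * b) = 0"
      by (rule null_mult) (simp_all add: row)
    ultimately have "p (b - a * b) = 0"
      using null_trans[OF null_sym, of "(\<Sum>k\<in>UNIV. u i k) * b" b "a * b"] by simp
    then show ?thesis
      using null_trans[OF a null_sym] by (simp add: a_def b_def)
  qed
  then have "p (l - r) = 0" if "(l, r) \<in> banica_rels \<epsilon>" for l r
    using that magic unfolding banica_rels_def by auto
  then show "p \<in> cstar_seminorms (banica_rels \<epsilon>)"
    using cstar_seminorm by (auto simp: cstar_seminorms_def)
qed

theorem proposition6p8:
  fixes \<epsilon> :: "nat^'n^'n"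
  assumes entries: "\<forall>i j. \<epsilon>$i$j \<in> {0, 1}"
    and symmetric: "\<forall>i j. \<epsilon>$i$j = \<epsilon>$j$i"
    and zero_diagonal: "\<forall>i. \<epsilon>$i$i = 0"
  shows "coincides (eps_sym_rels \<epsilon>) (bichon_rels \<epsilon>) \<and>
    quantum_subgroup (eps_sym_rels \<epsilon>) (banica_rels \<epsilon>)"
proof
  let ?E = "eps_sym_rels \<epsilon>" and ?B = "bichon_rels \<epsilon>"
  have "cstar_seminorms ?E = cstar_seminorms ?B"
    using eps_sym_subset_bichon[of \<epsilon>] bichon_subset_eps_sym[of \<epsilon>] entries symmetric by blast
  \<comment> \<open>The completion depends on the relations only through this seminorm, so the
    identity map will be the isomorphism.\<close>
  then have "univ_seminorm ?E = univ_seminorm ?B"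
    by (simp add: univ_seminorm_def fun_eq_iff)
  then have rel: "cauchy_seqs ?E = cauchy_seqs ?B" "cauchy_rel ?E = cauchy_rel ?B"
    and norm: "univ_seminorm ?E = univ_seminorm ?B"
    by (simp_all add: cauchy_seqs_def cauchy_rel_def)
  then have cls: "cauchy_class ?E = cauchy_class ?B"
    by (simp add: cauchy_class_def fun_eq_iff)
  have "univ_cstar ?E = univ_cstar ?B" "univ_gen ?E = univ_gen ?B"
    by (simp_all add: univ_cstar_def univ_gen_def fun_eq_iff rel cls norm)
  then show "coincides ?E ?B"
    by (auto simp: coincides_def star_iso_def star_hom_def ring_hom_def intro!: bexI[of _ "\<lambda>x. x"]
        bij_betw_id[unfolded id_def])
next
  let ?E = "eps_sym_rels \<epsilon>" and ?A = "banica_rels \<epsilon>"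
  have bdd: "\<And>x. bdd_above ((\<lambda>p. p x) ` cstar_seminorms ?E)"
    "\<And>x. bdd_above ((\<lambda>p. p x) ` cstar_seminorms ?A)"
    by (intro bdd_above_cstar_seminorms, force simp: eps_sym_rels_def banica_rels_def)+
  \<comment> \<open>Seminorms vanishing on the relations of \<open>?E\<close> vanish on those of
    \<open>?A\<close>, so \<open>?E\<close> has the smaller universal seminorm and the map runs from
    \<open>?A\<close> to \<open>?E\<close>.\<close>
  interpret univ_cstar_dominated ?A ?E
    by unfold_locales
      (intro cstar_seminorm_univ_seminorm bdd univ_seminorm_mono eps_sym_subset_banica entries[rule_format])+
  show "quantum_subgroup ?E ?A"
    unfolding quantum_subgroup_def
    using quotient_map_star_hom quotient_map_surj quotient_map_gen by blast
qed

end
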